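(* Let $K=\{x\in\mathbb{R}^n : c_i(x)=0\ (i\in\mathcal{E}),\ c_j(x)\ge 0\ (j\in\mathcal{I})\}$ with polynomials $c_i,c_j\in\mathbb{R}[x]$, and suppose $K$ is closed at $\infty$. Then: (i) For a degree $d>0$, $$int(\mathscr{P}_d(K))=\left\{p\in\mathbb{R}[x]_d : p|_K>0,\ p^{(d)}|_{K^e}>0\right\},$$ where $p^{(d)}$ denotes the homogeneous part of the degree-$d$ terms of $p$. (ii) For a finite set $\mathcal{A}\subseteq\mathbb{N}^n$, let $d=\deg(\mathcal{A})$. If $\mathbb{R}[x]_{\mathcal{A}}\cap int(\mathscr{P}_d(K))\ne\emptyset$, then $$int(\mathscr{P}_{\mathcal{A}}(K))=\left\{p\in\mathbb{R}[x]_{\mathcal{A}} : p|_K>0,\ p^{(d)}|_{K^e}>0\right\}.$$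
   Context: Notation: $x=(x_1,\dots,x_n)$, $\tilde{x}=(x_0,x)=(x_0,x_1,\dots,x_n)$. $\mathcal{E},\mathcal{I}$ are finite label sets. $\mathbb{R}[x]_d$ is the space of real polynomials in $x$ of degree $\le d$. For a finite $\mathcal{A}\subseteq\mathbb{N}^n$, $\deg(\mathcal{A})=\max\{|\alpha|:\alpha\in\mathcal{A}\}$ with $|\alpha|=\alpha_1+\dots+\alpha_n$, and $\mathbb{R}[x]_{\mathcal{A}}$ is the span of the monomials $x^\alpha$, $\alpha\in\mathcal{A}$. $\mathscr{P}_{\mathcal{A}}(K)=\{p\in\mathbb{R}[x]_{\mathcal{A}}:p\ge 0\text{ on }K\}$ and $\mathscr{P}_d(K)=\{p\in\mathbb{R}[x]_d:p\ge 0\text{ on }K\}$. Interiors $int$ are taken in $\mathbb{R}[x]_d$ and $\mathbb{R}[x]_{\mathcal{A}}$ respectively (Euclidean topology). "$p|_S>0$" means $p(x)>0$ for every $x\in S$. For a polynomial $p$, $p^{hom}$ is the homogeneous part of its highest degree terms and $\tilde{p}(\tilde{x})=x_0^{\deg(p)}p(x/x_0)$ is its homogenization. Define $$K^e=\{x\in\mathbb{R}^n : c_i^{hom}(x)=0\ (i\in\mathcal{E}),\ c_j^{hom}(x)\ge 0\ (j\in\mathcal{I}),\ \|x\|^2-1=0\},$$ $$\widetilde{K}^h=\{\tilde{x}\in\mathbb{R}^{n+1}:\tilde{c}_i(\tilde{x})=0\ (i\in\mathcal{E}),\ \tilde{c}_j(\tilde{x})\ge 0\ (j\in\mathcal{I}),\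 x_0\ge 0\},\quad \widetilde{K}^c=\widetilde{K}^h\cap\{x_0>0\}.$$ $K$ (with its describing polynomials) is closed at $\infty$ if $cl(\widetilde{K}^c)=\widetilde{K}^h$, where $cl$ is the Euclidean closure. *)

theory Defs
  imports "HOL-Analysis.Analysis" "HOL-Library.Poly_Mapping"
begin

section \<open>Real polynomials in several variables\<close>

text \<open>A finite index type \<^typ>\<open>'n\<close> names the variables. An exponent is a map from variables
  to naturals, and a polynomial is a finitely supported coefficient map on exponents.\<close>

type_synonym 'n expo = "'n \<Rightarrow>\<^sub>0 nat"
type_synonym 'n rpoly = "'n expo \<Rightarrow>\<^sub>0 real"

definition expo_deg :: "'n::finite expo \<Rightarrow> nat" where
  "expo_deg \<alpha> = (\<Sum>i\<in>UNIV. Poly_Mapping.lookup \<alpha> i)"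

definition monom_eval :: "'n::finite expo \<Rightarrow> real^'n \<Rightarrow> real" where
  "monom_eval \<alpha> x = (\<Prod>i\<in>UNIV. (x $ i) ^ Poly_Mapping.lookup \<alpha> i)"

definition peval :: "'n::finite rpoly \<Rightarrow> real^'n \<Rightarrow> real" where
  "peval p x = (\<Sum>\<alpha>\<in>Poly_Mapping.keys p. Poly_Mapping.lookup p \<alpha> * monom_eval \<alpha> x)"

text \<open>The inserted \<open>0\<close> only fixes the value on the empty set (so that the zero
  polynomial has degree \<open>0\<close>, as for univariate \<open>poly\<close>).\<close>

definition supp_deg :: "'n::finite expo set \<Rightarrow> nat" where
  "supp_deg A = Max (insert 0 (expo_deg ` A))"

definition pdeg :: "'n::finite rpoly \<Rightarrow> nat" where
  "pdeg p = supp_deg (Poly_Mapping.keys p)"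

definition hom_part :: "nat \<Rightarrow> 'n::finite rpoly \<Rightarrow> 'n rpoly" where
  "hom_part k p = (\<Sum>\<alpha>\<in>{\<alpha>\<in>Poly_Mapping.keys p. expo_deg \<alpha> = k}.
     Poly_Mapping.single \<alpha> (Poly_Mapping.lookup p \<alpha>))"

definition lead_form :: "'n::finite rpoly \<Rightarrow> 'n rpoly" where
  "lead_form p = hom_part (pdeg p) p"

text \<open>The homogenization, as a function of \<open>(x\<^sub>0, x)\<close>. It is written out monomial by monomial
  since \<open>x\<^sub>0 ^ deg p * p (x / x\<^sub>0)\<close> has the wrong value at \<open>x\<^sub>0 = 0\<close> when division is total;
  for nonzero \<open>x\<^sub>0\<close> the two agree, see \<open>homogenize_eq\<close>. The subtraction never truncates.\<close>

definition homogenize :: "'n::finite rpoly \<Rightarrow> real \<times> (real^'n) \<Rightarrow> real" where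
  "homogenize p = (\<lambda>(x0, x).
     \<Sum>\<alpha>\<in>Poly_Mapping.keys p. Poly_Mapping.lookup p \<alpha> * x0 ^ (pdeg p - expo_deg \<alpha>) * monom_eval \<alpha> x)"

lemma expo_deg_le_pdeg: "\<alpha> \<in> Poly_Mapping.keys p \<Longrightarrow> expo_deg \<alpha> \<le> pdeg p"
  by (simp add: pdeg_def supp_deg_def)

lemma monom_eval_scaleR: "monom_eval \<alpha> (r *\<^sub>R x) = r ^ expo_deg \<alpha> * monom_eval \<alpha> x"
  by (simp add: monom_eval_def expo_deg_def power_mult_distrib prod.distrib power_sum)

lemma homogenize_eq:
  assumes "x0 \<noteq> 0"
  shows "homogenize p (x0, x) = x0 ^ pdeg p * peval p (x /\<^sub>R x0)"
proof -
  have "x0 ^ (pdeg p - expo_deg \<alpha>) * monom_eval \<alpha> x = x0 ^ pdeg p * monom_eval \<alpha> (x /\<^sub>R x0)"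
    if "\<alpha> \<in> Poly_Mapping.keys p" for \<alpha>
    using assms expo_deg_le_pdeg[OF that]
    by (simp add: monom_eval_scaleR power_diff power_inverse divide_inverse)
  then show ?thesis
    by (simp add: homogenize_def peval_def sum_distrib_left mult.assoc mult.left_commute)
qed

lemma lookup_hom_part:
  "Poly_Mapping.lookup (hom_part k p) \<alpha> = (if expo_deg \<alpha> = k then Poly_Mapping.lookup p \<alpha> else 0)"
  by (auto simp: hom_part_def lookup_sum lookup_single when_def in_keys_iff)

lemma homogenize_0: "homogenize p (0, x) = peval (lead_form p) x"
proof -
  have "Poly_Mapping.keys (lead_form p) = {\<alpha>\<in>Poly_Mapping.keys p. expo_deg \<alpha> = pdeg p}"
    by (auto simp: lead_form_def lookup_hom_part in_keys_iff split: if_splits)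
  moreover have "(\<Sum>\<alpha>\<in>Poly_Mapping.keys p. Poly_Mapping.lookup p \<alpha> * 0 ^ (pdeg p - expo_deg \<alpha>) * monom_eval \<alpha> x)
      = (\<Sum>\<alpha>\<in>{\<alpha>\<in>Poly_Mapping.keys p. expo_deg \<alpha> = pdeg p}. Poly_Mapping.lookup p \<alpha> * monom_eval \<alpha> x)"
  proof (rule sum.mono_neutral_cong_right)
    show "\<forall>\<alpha>\<in>Poly_Mapping.keys p - {\<alpha>\<in>Poly_Mapping.keys p. expo_deg \<alpha> = pdeg p}.
        Poly_Mapping.lookup p \<alpha> * 0 ^ (pdeg p - expo_deg \<alpha>) * monom_eval \<alpha> x = 0"
    proof
      fix \<alpha> assume "\<alpha> \<in> Poly_Mapping.keys p - {\<alpha>\<in>Poly_Mapping.keys p. expo_deg \<alpha> = pdeg p}"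
      then have "expo_deg \<alpha> < pdeg p"
        using expo_deg_le_pdeg[of \<alpha> p] by auto
      then show "Poly_Mapping.lookup p \<alpha> * 0 ^ (pdeg p - expo_deg \<alpha>) * monom_eval \<alpha> x = 0"
        by simp
    qed
  qed auto
  ultimately show ?thesis
    by (simp add: homogenize_def peval_def lead_form_def lookup_hom_part)
qed


section \<open>Spaces of polynomials and their Euclidean topology\<close>

definition polys_deg :: "nat \<Rightarrow> 'n::finite rpoly set" where
  "polys_deg d = {p. pdeg p \<le> d}"

definition polys_supp :: "'n::finite expo set \<Rightarrow> 'n rpoly set" where
  "polys_supp A = {p. Poly_Mapping.keys p \<subseteq> A}"

lemma polys_supp_eq_span:
  fixes A :: "'a::finite expo set"
  assumes "finite A"
  shows "polys_supp A = range (\<lambda>a. \<Sum>\<alpha>\<in>A. Poly_Mapping.single \<alpha> (a \<alpha>))"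
proof (intro set_eqI iffI)
  fix p :: "'a rpoly" assume "p \<in> polys_supp A"
  then have "p = (\<Sum>\<alpha>\<in>A. Poly_Mapping.single \<alpha> (Poly_Mapping.lookup p \<alpha>))"
    using assms by (intro poly_mapping_eqI)
      (auto simp: polys_supp_def lookup_sum lookup_single when_def in_keys_iff)
  then show "p \<in> range (\<lambda>a. \<Sum>\<alpha>\<in>A. Poly_Mapping.single \<alpha> (a \<alpha>))"
    by blast
next
  fix p :: "'a rpoly" assume "p \<in> range (\<lambda>a. \<Sum>\<alpha>\<in>A. Poly_Mapping.single \<alpha> (a \<alpha>))"
  then show "p \<in> polys_supp A"
    using assms by (auto simp: polys_supp_def lookup_sum lookup_single when_def in_keys_iff
        split: if_splits)
qed

text \<open>The Euclidean distance of the coefficient vectors.\<close>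

definition coeff_dist :: "'n rpoly \<Rightarrow> 'n rpoly \<Rightarrow> real" where
  "coeff_dist p q = L2_set (Poly_Mapping.lookup (p - q)) (Poly_Mapping.keys (p - q))"

lemma coeff_dist_superset:
  assumes "finite B" "Poly_Mapping.keys (p - q) \<subseteq> B"
  shows "coeff_dist p q = L2_set (Poly_Mapping.lookup (p - q)) B"
  using assms by (auto simp: coeff_dist_def L2_set_def in_keys_iff
      intro!: sum.mono_neutral_left)

lemma Metric_space_coeff_dist: "Metric_space V coeff_dist"
proof
  fix p q r :: "'n rpoly"
  show "0 \<le> coeff_dist p q"
    by (simp add: coeff_dist_def)
  let ?B = "Poly_Mapping.keys (p - q) \<union> Poly_Mapping.keys (q - r) \<union> Poly_Mapping.keys (p - r) \<union> Poly_Mapping.keys (q - p)"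
  have B: "coeff_dist p q = L2_set (Poly_Mapping.lookup (p - q)) ?B" "coeff_dist q p = L2_set (Poly_Mapping.lookup (q - p)) ?B"
    "coeff_dist q r = L2_set (Poly_Mapping.lookup (q - r)) ?B" "coeff_dist p r = L2_set (Poly_Mapping.lookup (p - r)) ?B"
    by (rule coeff_dist_superset; force)+
  show "coeff_dist p q = coeff_dist q p"
    unfolding B by (simp add: L2_set_def lookup_minus power2_commute)
  have "Poly_Mapping.lookup (p - r) = (\<lambda>\<alpha>. Poly_Mapping.lookup (p - q) \<alpha> + Poly_Mapping.lookup (q - r) \<alpha>)"
    by (auto simp: lookup_minus)
  then show "coeff_dist p r \<le> coeff_dist p q + coeff_dist q r"
    unfolding B by (simp add: L2_set_triangle_ineq)
  show "coeff_dist p q = 0 \<longleftrightarrow> p = q"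
    unfolding coeff_dist_def by (subst L2_set_eq_0_iff) (auto simp: in_keys_iff lookup_minus intro!: poly_mapping_eqI)
qed

text \<open>Interior of \<open>S\<close> relative to the finite-dimensional space \<open>V\<close>.\<close>

definition interior_wrt :: "'n rpoly set \<Rightarrow> 'n rpoly set \<Rightarrow> 'n rpoly set" where
  "interior_wrt V S = Metric_space.mtopology V coeff_dist interior_of S"

definition nonneg_polys_deg :: "nat \<Rightarrow> (real^'n) set \<Rightarrow> 'n::finite rpoly set" where
  "nonneg_polys_deg d K = {p \<in> polys_deg d. \<forall>x\<in>K. peval p x \<ge> 0}"

definition nonneg_polys_supp :: "'n expo set \<Rightarrow> (real^'n) set \<Rightarrow> 'n::finite rpoly set" where
  "nonneg_polys_supp A K = {p \<in> polys_supp A. \<forall>x\<in>K. peval p x \<ge> 0}"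


section \<open>Basic semialgebraic sets and closedness at infinity\<close>

text \<open>\<open>E\<close> labels the equality constraints and \<open>I\<close> the inequality constraints. Closedness at
  infinity depends on the describing polynomials \<open>c\<close>, not just on the set they define.\<close>

definition semialg_set :: "('l \<Rightarrow> 'n::finite rpoly) \<Rightarrow> 'l set \<Rightarrow> 'l set \<Rightarrow> (real^'n) set" where
  "semialg_set c E I = {x. (\<forall>i\<in>E. peval (c i) x = 0) \<and> (\<forall>j\<in>I. peval (c j) x \<ge> 0)}"

text \<open>The set \<open>K\<^sup>e\<close>.\<close>

definition semialg_inf :: "('l \<Rightarrow> 'n::finite rpoly) \<Rightarrow> 'l set \<Rightarrow> 'l set \<Rightarrow> (real^'n) set" where
  "semialg_inf c E I = {x. (\<forall>i\<in>E. peval (lead_form (c i)) x = 0) \<and>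
     (\<forall>j\<in>I. peval (lead_form (c j)) x \<ge> 0) \<and> (norm x)\<^sup>2 - 1 = 0}"

text \<open>The homogenized set \<open>K\<^sup>h\<close> and its part \<open>K\<^sup>c\<close> off the hyperplane at infinity.\<close>

definition semialg_hom :: "('l \<Rightarrow> 'n::finite rpoly) \<Rightarrow> 'l set \<Rightarrow> 'l set \<Rightarrow> (real \<times> (real^'n)) set" where
  "semialg_hom c E I = {(x0, x). (\<forall>i\<in>E. homogenize (c i) (x0, x) = 0) \<and>
     (\<forall>j\<in>I. homogenize (c j) (x0, x) \<ge> 0) \<and> x0 \<ge> 0}"

definition semialg_cone :: "('l \<Rightarrow> 'n::finite rpoly) \<Rightarrow> 'l set \<Rightarrow> 'l set \<Rightarrow> (real \<times> (real^'n)) set" where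
  "semialg_cone c E I = semialg_hom c E I \<inter> {(x0, x). x0 > 0}"

definition closed_at_infinity :: "('l \<Rightarrow> 'n::finite rpoly) \<Rightarrow> 'l set \<Rightarrow> 'l set \<Rightarrow> bool" where
  "closed_at_infinity c E I \<longleftrightarrow> closure (semialg_cone c E I) = semialg_hom c E I"

end

theory Submission
  imports Defs
begin

text \<open>Homogenizing to degree \<open>d\<close> turns both positivity conditions into one. For \<open>p\<close> of degree at
  most \<open>d\<close> put \<open>P(x\<^sub>0, x) = (\<Sum>\<alpha>. p\<^sub>\<alpha> x\<^sub>0 ^ (d - |\<alpha>|) x ^ \<alpha>)\<close>. Then \<open>P(1, x) = p(x)\<close> and
  \<open>P(0, x) = p\<^sup>(\<^sup>d\<^sup>)(x)\<close>, so \<open>p\<close> is positive on \<open>K\<close> and \<open>p\<^sup>(\<^sup>d\<^sup>)\<close> is positive on \<open>K\<^sup>e\<close> exactly when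
  \<open>P\<close> is positive on the compact set of unit vectors of the closed cone \<open>K\<^sup>h\<close>. Compactness gives a
  positive minimum there, and on the unit sphere \<open>P\<close> changes by at most a constant times the
  change of the coefficients. Hence such a \<open>p\<close> is interior (lemma \<open>pos_imp_interior\<close>); this
  direction does not need closedness at infinity.

  Conversely, if \<open>p\<close> is interior and \<open>r\<close> is any polynomial of the same space, then
  \<open>p - \<epsilon> r \<ge> 0\<close> on \<open>K\<close> for some \<open>\<epsilon> > 0\<close>. So the homogenization of \<open>p - \<epsilon> r\<close> is nonnegative on
  \<open>K\<^sup>c\<close>, and by closedness at infinity on the whole of \<open>K\<^sup>h\<close>; thus \<open>p\<close> and \<open>p\<^sup>(\<^sup>d\<^sup>)\<close> dominate
  \<open>\<epsilon> r\<close> and \<open>\<epsilon> r\<^sup>(\<^sup>d\<^sup>)\<close> (lemma \<open>interior_dominates\<close>). In the full space of polynomials of degree at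
  most \<open>d\<close>, take \<open>r = 1\<close> for the points of \<open>K\<close>, and \<open>r = \<plusminus> x\<^sub>i ^ d\<close> with \<open>x\<^sub>i \<noteq> 0\<close> for a point \<open>x\<close> of
  \<open>K\<^sup>e\<close>. For a support \<open>A\<close>, these need not be available; there take \<open>r\<close> to be the given polynomial
  supported in \<open>A\<close> and interior in the full space, which is strictly positive on \<open>K\<close> and at
  infinity by the case just treated.\<close>

section \<open>Homogenization to a prescribed degree\<close>

text \<open>The homogenization of \<open>p\<close> to degree \<open>d\<close>, as a function of \<open>(x\<^sub>0, x)\<close>. It is meant for
  \<open>pdeg p \<le> d\<close>; fixing \<open>d\<close> independently of \<open>p\<close> makes it linear in \<open>p\<close>.\<close>

definition homogenize_to :: "nat \<Rightarrow> 'n::finite rpoly \<Rightarrow> real \<times> (real^'n) \<Rightarrow> real" where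
  "homogenize_to d p z = (\<Sum>\<alpha>\<in>Poly_Mapping.keys p.
     Poly_Mapping.lookup p \<alpha> * (fst z ^ (d - expo_deg \<alpha>) * monom_eval \<alpha> (snd z)))"

lemma homogenize_to_superset:
  assumes "finite B" "Poly_Mapping.keys p \<subseteq> B"
  shows "homogenize_to d p z =
    (\<Sum>\<alpha>\<in>B. Poly_Mapping.lookup p \<alpha> * (fst z ^ (d - expo_deg \<alpha>) * monom_eval \<alpha> (snd z)))"
  unfolding homogenize_to_def using assms by (intro sum.mono_neutral_left) (auto simp: in_keys_iff)

lemma homogenize_to_diff: "homogenize_to d (p - q) z = homogenize_to d p z - homogenize_to d q z"
proof -
  let ?B = "Poly_Mapping.keys p \<union> Poly_Mapping.keys q"
  have "Poly_Mapping.keys (p - q) \<subseteq> ?B"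
    by (rule keys_diff)
  then show ?thesis
    by (simp add: homogenize_to_superset[where B = ?B] lookup_minus left_diff_distrib sum_subtractf)
qed

lemma homogenize_to_1: "homogenize_to d p (1, x) = peval p x"
  by (simp add: homogenize_to_def peval_def)

lemma pdeg_le_iff: "pdeg p \<le> d \<longleftrightarrow> (\<forall>\<alpha>\<in>Poly_Mapping.keys p. expo_deg \<alpha> \<le> d)"
  by (simp add: pdeg_def supp_deg_def)

lemma homogenize_to_0:
  assumes "pdeg p \<le> d"
  shows "homogenize_to d p (0, x) = peval (hom_part d p) x"
proof -
  have "Poly_Mapping.keys (hom_part d p) = {\<alpha> \<in> Poly_Mapping.keys p. expo_deg \<alpha> = d}"
    by (auto simp: lookup_hom_part in_keys_iff split: if_splits)
  moreover have "homogenize_to d p (0, x) =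
      (\<Sum>\<alpha>\<in>{\<alpha> \<in> Poly_Mapping.keys p. expo_deg \<alpha> = d}. Poly_Mapping.lookup p \<alpha> * monom_eval \<alpha> x)"
    unfolding homogenize_to_def
    using assms by (intro sum.mono_neutral_cong_right) (force simp: pdeg_le_iff)+
  ultimately show ?thesis
    by (simp add: peval_def lookup_hom_part)
qed

lemma homogenize_to_scaleR:
  assumes "pdeg p \<le> d"
  shows "homogenize_to d p (t *\<^sub>R z) = t ^ d * homogenize_to d p z"
proof -
  have "(t * fst z) ^ (d - expo_deg \<alpha>) * (t ^ expo_deg \<alpha> * monom_eval \<alpha> (snd z))
      = t ^ d * (fst z ^ (d - expo_deg \<alpha>) * monom_eval \<alpha> (snd z))"
    if "\<alpha> \<in> Poly_Mapping.keys p" for \<alpha>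
  proof -
    have "t ^ d = t ^ (d - expo_deg \<alpha>) * t ^ expo_deg \<alpha>"
      using assms that by (simp add: pdeg_le_iff flip: power_add)
    then show ?thesis
      by (simp add: power_mult_distrib)
  qed
  then show ?thesis
    unfolding homogenize_to_def sum_distrib_left
    by (intro sum.cong) (simp_all add: monom_eval_scaleR mult.left_commute[of "t ^ d"])
qed

lemma continuous_on_homogenize_to: "continuous_on S (homogenize_to d p)"
  unfolding homogenize_to_def[abs_def] monom_eval_def by (intro continuous_intros)

lemma homogenize_eq_homogenize_to: "homogenize p = homogenize_to (pdeg p) p"
  by (auto simp: homogenize_def homogenize_to_def mult.assoc)

text \<open>On the closed unit ball every monomial is bounded by \<open>1\<close>, hence the bound in terms of
  the coefficient distance.\<close>

lemma homogenize_to_diff_le: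
  fixes p q :: "'n::finite rpoly"
  assumes "finite A" "p \<in> polys_supp A" "q \<in> polys_supp A" "norm z \<le> 1"
  shows "\<bar>homogenize_to d p z - homogenize_to d q z\<bar> \<le> card A * coeff_dist p q"
proof -
  have sub: "Poly_Mapping.keys (p - q) \<subseteq> A"
    using assms(2,3) keys_diff[of p q] by (auto simp: polys_supp_def)
  have coeff: "\<bar>Poly_Mapping.lookup (p - q) \<alpha>\<bar> \<le> coeff_dist p q" if "\<alpha> \<in> A" for \<alpha>
  proof -
    have "\<bar>Poly_Mapping.lookup (p - q) \<alpha>\<bar> \<le> L2_set (\<lambda>\<alpha>. \<bar>Poly_Mapping.lookup (p - q) \<alpha>\<bar>) A"
      using assms(1) that by (rule member_le_L2_set)
    then show ?thesis
      using coeff_dist_superset[OF assms(1) sub] by (simp add: L2_set_def)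
  qed
  have fst: "\<bar>fst z\<bar> \<le> 1" and snd: "norm (snd z) \<le> 1"
    using assms(4) norm_fst_le[of "fst z" "snd z"] norm_snd_le[of "snd z" "fst z"] by auto
  have mono: "\<bar>fst z ^ k * monom_eval \<alpha> (snd z)\<bar> \<le> 1" for k and \<alpha> :: "'n expo"
  proof -
    have "\<bar>snd z $ i\<bar> \<le> 1" for i
      using component_le_norm_cart[of "snd z" i] snd by linarith
    then have "\<bar>monom_eval \<alpha> (snd z)\<bar> \<le> 1"
      unfolding monom_eval_def abs_prod power_abs by (intro prod_le_1) (auto intro: power_le_one)
    moreover have "\<bar>fst z ^ k\<bar> \<le> 1"
      unfolding power_abs using fst by (auto intro: power_le_one)
    ultimately show ?thesis
      unfolding abs_mult by (intro mult_le_one) auto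
  qed
  have "\<bar>homogenize_to d p z - homogenize_to d q z\<bar> = \<bar>homogenize_to d (p - q) z\<bar>"
    by (simp add: homogenize_to_diff)
  also have "\<dots> \<le> (\<Sum>\<alpha>\<in>A. \<bar>Poly_Mapping.lookup (p - q) \<alpha> *
      (fst z ^ (d - expo_deg \<alpha>) * monom_eval \<alpha> (snd z))\<bar>)"
    unfolding homogenize_to_superset[OF assms(1) sub] by (rule sum_abs)
  also have "\<dots> \<le> (\<Sum>\<alpha>\<in>A. coeff_dist p q * 1)"
    unfolding abs_mult[of "Poly_Mapping.lookup _ _"]
    by (intro sum_mono mult_mono coeff mono) (auto simp: coeff_dist_def)
  finally show ?thesis
    by simp
qed


section \<open>Polynomial spaces\<close>

lemma finite_expo_deg_le: "finite {\<alpha> :: 'n::finite expo. expo_deg \<alpha> \<le> d}"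
proof (rule finite_imageD)
  have "Poly_Mapping.lookup \<alpha> i \<le> expo_deg \<alpha>" for \<alpha> :: "'n expo" and i
    unfolding expo_deg_def by (rule member_le_sum) auto
  then have "Poly_Mapping.lookup ` {\<alpha> :: 'n expo. expo_deg \<alpha> \<le> d} \<subseteq> (\<Pi>\<^sub>E i\<in>UNIV. {..d})"
    by (auto intro: order_trans)
  then show "finite (Poly_Mapping.lookup ` {\<alpha> :: 'n expo. expo_deg \<alpha> \<le> d})"
    by (rule finite_subset) (auto intro: finite_PiE)
  show "inj_on Poly_Mapping.lookup {\<alpha> :: 'n expo. expo_deg \<alpha> \<le> d}"
    by (auto simp: inj_on_def lookup_inject)
qed

lemma polys_deg_eq_polys_supp: "polys_deg d = polys_supp {\<alpha>. expo_deg \<alpha> \<le> d}"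
  by (auto simp: polys_deg_def polys_supp_def pdeg_le_iff)

lemma nonneg_polys_deg_eq: "nonneg_polys_deg d K = nonneg_polys_supp {\<alpha>. expo_deg \<alpha> \<le> d} K"
  by (simp add: nonneg_polys_deg_def nonneg_polys_supp_def polys_deg_eq_polys_supp)

lemma interior_wrt_iff:
  "p \<in> interior_wrt V S \<longleftrightarrow> p \<in> V \<and> (\<exists>\<delta>>0. \<forall>q\<in>V. coeff_dist p q < \<delta> \<longrightarrow> q \<in> S)"
proof -
  interpret Metric_space V coeff_dist
    by (rule Metric_space_coeff_dist)
  show ?thesis
    unfolding interior_wrt_def in_interior_of_mball by (auto simp: subset_eq)
qed

text \<open>Scalar multiples of a polynomial.\<close>

abbreviation smult_rpoly :: "real \<Rightarrow> 'n rpoly \<Rightarrow> 'n rpoly" where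
  "smult_rpoly a p \<equiv> Poly_Mapping.map ((*) a) p"

lemma lookup_smult_rpoly:
  "Poly_Mapping.lookup (smult_rpoly a p) \<alpha> = a * Poly_Mapping.lookup p \<alpha>"
  by (simp add: map.rep_eq when_def)

lemma keys_smult_rpoly: "Poly_Mapping.keys (smult_rpoly a p) \<subseteq> Poly_Mapping.keys p"
  by (auto simp: in_keys_iff lookup_smult_rpoly)

lemma homogenize_to_smult: "homogenize_to d (smult_rpoly a p) z = a * homogenize_to d p z"
  unfolding homogenize_to_superset[OF finite_keys keys_smult_rpoly]
  by (simp add: homogenize_to_def lookup_smult_rpoly sum_distrib_left mult.assoc)

lemma coeff_dist_diff_smult:
  assumes "a \<ge> 0"
  shows "coeff_dist p (p - smult_rpoly a r) = a * coeff_dist r 0"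
proof -
  have "coeff_dist p (p - smult_rpoly a r) =
      L2_set (Poly_Mapping.lookup (p - (p - smult_rpoly a r))) (Poly_Mapping.keys r)"
    using keys_smult_rpoly[of a r] by (intro coeff_dist_superset) auto
  also have "\<dots> = L2_set (\<lambda>\<alpha>. a * Poly_Mapping.lookup r \<alpha>) (Poly_Mapping.keys r)"
    by (intro L2_set_cong) (auto simp: lookup_smult_rpoly)
  finally show ?thesis
    using assms by (simp add: coeff_dist_def L2_set_right_distrib)
qed

lemma interior_wrt_perturb:
  assumes p: "p \<in> interior_wrt (polys_supp A) S" and r: "r \<in> polys_supp A"
  obtains \<epsilon> where "\<epsilon> > 0" "p - smult_rpoly \<epsilon> r \<in> S"
proof -
  from p obtain \<delta> where "\<delta> > 0" and pA: "p \<in> polys_supp A"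
    and \<delta>: "\<And>q. q \<in> polys_supp A \<Longrightarrow> coeff_dist p q < \<delta> \<Longrightarrow> q \<in> S"
    by (auto simp: interior_wrt_iff)
  have nn: "coeff_dist r 0 \<ge> 0"
    by (simp add: coeff_dist_def)
  define \<epsilon> where "\<epsilon> = \<delta> / (coeff_dist r 0 + 1)"
  have "\<epsilon> > 0"
    using \<open>\<delta> > 0\<close> nn by (simp add: \<epsilon>_def)
  moreover have "\<epsilon> * coeff_dist r 0 < \<delta>"
    using \<open>\<delta> > 0\<close> nn by (simp add: \<epsilon>_def field_simps)
  moreover have "p - smult_rpoly \<epsilon> r \<in> polys_supp A"
    using pA r keys_diff[of p "smult_rpoly \<epsilon> r"] keys_smult_rpoly[of \<epsilon> r]
    unfolding polys_supp_def by blast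
  ultimately show thesis
    using that \<delta> coeff_dist_diff_smult[of \<epsilon> p r] by auto
qed


section \<open>The homogenized cone\<close>

lemma semialg_hom_iff:
  "z \<in> semialg_hom c E I \<longleftrightarrow> (\<forall>i\<in>E. homogenize_to (pdeg (c i)) (c i) z = 0) \<and>
     (\<forall>j\<in>I. homogenize_to (pdeg (c j)) (c j) z \<ge> 0) \<and> fst z \<ge> 0"
  by (cases z) (simp add: semialg_hom_def homogenize_eq_homogenize_to)

lemma closed_semialg_hom: "closed (semialg_hom c E I)"
proof -
  have "semialg_hom c E I = (\<Inter>i\<in>E. {z. homogenize_to (pdeg (c i)) (c i) z = 0}) \<inter>
      (\<Inter>j\<in>I. {z. homogenize_to (pdeg (c j)) (c j) z \<ge> 0}) \<inter> {z. fst z \<ge> 0}"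
    by (auto simp: semialg_hom_iff)
  then show ?thesis
    by (auto intro!: closed_Int closed_INT closed_Collect_eq closed_Collect_le
        continuous_on_homogenize_to continuous_intros)
qed

lemma semialg_hom_scaleR: "z \<in> semialg_hom c E I \<Longrightarrow> t > 0 \<Longrightarrow> t *\<^sub>R z \<in> semialg_hom c E I"
  by (simp add: semialg_hom_iff homogenize_to_scaleR)

lemma semialg_hom_1: "(1, x) \<in> semialg_hom c E I \<longleftrightarrow> x \<in> semialg_set c E I"
  by (simp add: semialg_hom_iff semialg_set_def homogenize_to_1)

lemma semialg_hom_0: "norm x = 1 \<Longrightarrow> (0, x) \<in> semialg_hom c E I \<longleftrightarrow> x \<in> semialg_inf c E I"
  by (simp add: semialg_hom_iff semialg_inf_def homogenize_to_0 lead_form_def)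

lemma norm_semialg_inf: "x \<in> semialg_inf c E I \<Longrightarrow> norm x = 1"
  using power2_eq_1_iff[of "norm x"] norm_ge_zero[of x] by (auto simp: semialg_inf_def)

lemma semialg_hom_pos:
  assumes z: "z \<in> semialg_hom c E I" "fst z > 0"
  obtains x where "x \<in> semialg_set c E I" "z = fst z *\<^sub>R (1, x)"
proof
  show eq: "z = fst z *\<^sub>R (1, snd z /\<^sub>R fst z)"
    using z(2) by (simp add: prod_eq_iff)
  have "(1, snd z /\<^sub>R fst z) = inverse (fst z) *\<^sub>R z"
    using z(2) by (simp add: prod_eq_iff)
  also have "\<dots> \<in> semialg_hom c E I"
    using z by (intro semialg_hom_scaleR) auto
  finally show "snd z /\<^sub>R fst z \<in> semialg_set c E I"
    by (simp only: semialg_hom_1)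
qed

lemma homogenize_to_pos_on_hom:
  assumes deg: "pdeg p \<le> d"
    and K: "\<And>x. x \<in> semialg_set c E I \<Longrightarrow> peval p x > 0"
    and Ke: "\<And>x. x \<in> semialg_inf c E I \<Longrightarrow> peval (hom_part d p) x > 0"
    and z: "z \<in> semialg_hom c E I" "norm z = 1"
  shows "homogenize_to d p z > 0"
proof (cases "fst z = 0")
  case True
  then have "z = (0, snd z)" "norm (snd z) = 1"
    using z(2) by (cases z; simp)+
  then show ?thesis
    using Ke z(1) semialg_hom_0 homogenize_to_0[OF deg] by metis
next
  case False
  then have pos: "fst z > 0"
    using z(1) by (simp add: semialg_hom_iff)
  then obtain x where "x \<in> semialg_set c E I" and z_eq: "z = fst z *\<^sub>R (1, x)"
    using semialg_hom_pos z(1) by blast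
  then have "fst z ^ d * homogenize_to d p (1, x) > 0"
    using K pos by (simp add: homogenize_to_1)
  then show ?thesis
    by (subst z_eq) (simp only: homogenize_to_scaleR[OF deg])
qed

text \<open>Closedness at infinity is what carries nonnegativity on \<open>K\<close> over to the
  directions at infinity.\<close>

lemma nonneg_imp_nonneg_at_infinity:
  assumes closed: "closed_at_infinity c E I" and deg: "pdeg p \<le> d"
    and K: "\<And>x. x \<in> semialg_set c E I \<Longrightarrow> peval p x \<ge> 0"
    and z: "z \<in> semialg_hom c E I"
  shows "homogenize_to d p z \<ge> 0"
proof -
  have "homogenize_to d p w \<ge> 0" if "w \<in> semialg_cone c E I" for w
  proof -
    have w: "w \<in> semialg_hom c E I" "fst w > 0"
      using that by (auto simp: semialg_cone_def)
    then obtain x where "x \<in> semialg_set c E I" and w_eq: "w = fst w *\<^sub>R (1, x)"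
      using semialg_hom_pos by blast
    then have "fst w ^ d * homogenize_to d p (1, x) \<ge> 0"
      using K w(2) by (simp add: homogenize_to_1)
    then show ?thesis
      by (subst w_eq) (simp only: homogenize_to_scaleR[OF deg])
  qed
  then have "closure (semialg_cone c E I) \<subseteq> {w. homogenize_to d p w \<ge> 0}"
    by (intro closure_minimal closed_Collect_le continuous_on_homogenize_to continuous_intros) auto
  then show ?thesis
    using closed z by (auto simp: closed_at_infinity_def)
qed


section \<open>Interior points and strict positivity\<close>

lemma pos_imp_interior:
  fixes c :: "'l \<Rightarrow> 'n::finite rpoly"
  assumes A: "finite A" "\<And>\<alpha>. \<alpha> \<in> A \<Longrightarrow> expo_deg \<alpha> \<le> d" and p: "p \<in> polys_supp A"
    and K: "\<And>x. x \<in> semialg_set c E I \<Longrightarrow> peval p x > 0"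
    and Ke: "\<And>x. x \<in> semialg_inf c E I \<Longrightarrow> peval (hom_part d p) x > 0"
  shows "p \<in> interior_wrt (polys_supp A) (nonneg_polys_supp A (semialg_set c E I))"
proof -
  have deg: "pdeg q \<le> d" if "q \<in> polys_supp A" for q
    using that A(2) by (auto simp: polys_supp_def pdeg_le_iff)
  define S where "S = semialg_hom c E I \<inter> sphere 0 1"
  have "compact S"
    by (simp add: S_def closed_semialg_hom closed_Int_compact)
  obtain m where "m > 0" and m: "\<And>z. z \<in> S \<Longrightarrow> homogenize_to d p z \<ge> m"
  proof (cases "S = {}")
    case True
    then show ?thesis
      using that[of 1] by simp
  next
    case False
    then obtain z0 where "z0 \<in> S" "\<And>z. z \<in> S \<Longrightarrow> homogenize_to d p z0 \<le> homogenize_to d p z"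
      using continuous_attains_inf[OF \<open>compact S\<close> _ continuous_on_homogenize_to] by blast
    moreover from \<open>z0 \<in> S\<close> have "homogenize_to d p z0 > 0"
      by (intro homogenize_to_pos_on_hom[OF deg[OF p] K Ke]) (auto simp: S_def)
    ultimately show ?thesis
      using that by blast
  qed
  \<comment> \<open>The \<open>1\<close> in the denominator only guards against an empty \<open>A\<close>.\<close>
  have "q \<in> nonneg_polys_supp A (semialg_set c E I)"
    if q: "q \<in> polys_supp A" and dist: "coeff_dist p q < m / (card A + 1)" for q
  proof -
    have "coeff_dist p q \<ge> 0"
      by (simp add: coeff_dist_def)
    then have small: "card A * coeff_dist p q < m"
      using dist by (simp add: field_simps)
    have "peval q x \<ge> 0" if "x \<in> semialg_set c E I" for x
    proof -
      define t where "t = norm (1 :: real, x)"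
      have "t > 0"
        by (simp add: t_def prod_eq_iff)
      define z where "z = inverse t *\<^sub>R (1 :: real, x)"
      have "z \<in> semialg_hom c E I"
        unfolding z_def using that \<open>t > 0\<close> by (intro semialg_hom_scaleR) (auto simp: semialg_hom_1)
      moreover have "norm z = 1"
        using \<open>t > 0\<close> unfolding z_def norm_scaleR t_def[symmetric] by simp
      ultimately have "homogenize_to d p z \<ge> m"
        and "\<bar>homogenize_to d p z - homogenize_to d q z\<bar> \<le> card A * coeff_dist p q"
        using m homogenize_to_diff_le[OF A(1) p q] by (simp_all add: S_def)
      then have "homogenize_to d q z \<ge> 0"
        using small by linarith
      then have "t ^ d * homogenize_to d q z \<ge> 0"
        using \<open>t > 0\<close> by simp
      moreover have "t *\<^sub>R z = (1, x)"
        using \<open>t > 0\<close> by (simp add: z_def)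
      ultimately show ?thesis
        using homogenize_to_scaleR[OF deg[OF q], of t z] by (simp add: homogenize_to_1)
    qed
    then show ?thesis
      using q by (simp add: nonneg_polys_supp_def)
  qed
  moreover have "m / (card A + 1) > 0"
    using \<open>m > 0\<close> by simp
  ultimately show ?thesis
    using p by (auto simp: interior_wrt_iff)
qed

lemma interior_dominates:
  assumes closed: "closed_at_infinity c E I" and A: "\<And>\<alpha>. \<alpha> \<in> A \<Longrightarrow> expo_deg \<alpha> \<le> d"
    and p: "p \<in> interior_wrt (polys_supp A) (nonneg_polys_supp A (semialg_set c E I))"
    and r: "r \<in> polys_supp A"
  shows "\<exists>\<epsilon>>0. (\<forall>x\<in>semialg_set c E I. peval p x \<ge> \<epsilon> * peval r x) \<and>
    (\<forall>x\<in>semialg_inf c E I. peval (hom_part d p) x \<ge> \<epsilon> * peval (hom_part d r) x)"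
proof -
  obtain \<epsilon> where "\<epsilon> > 0"
    and q: "p - smult_rpoly \<epsilon> r \<in> nonneg_polys_supp A (semialg_set c E I)"
    using interior_wrt_perturb[OF p r] .
  have deg: "pdeg q \<le> d" if "q \<in> polys_supp A" for q
    using that A by (auto simp: polys_supp_def pdeg_le_iff)
  have "p \<in> polys_supp A"
    using p by (simp add: interior_wrt_iff)
  have *: "homogenize_to d p z \<ge> \<epsilon> * homogenize_to d r z" if "z \<in> semialg_hom c E I" for z
  proof -
    have "homogenize_to d (p - smult_rpoly \<epsilon> r) z \<ge> 0"
      using q deg by (intro nonneg_imp_nonneg_at_infinity[OF closed _ _ that])
        (auto simp: nonneg_polys_supp_def)
    then show ?thesis
      by (simp add: homogenize_to_diff homogenize_to_smult)
  qed
  show ?thesis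
  proof (intro exI[of _ \<epsilon>] conjI ballI \<open>\<epsilon> > 0\<close>)
    show "peval p x \<ge> \<epsilon> * peval r x" if "x \<in> semialg_set c E I" for x
      using *[of "(1, x)"] that by (simp add: semialg_hom_1 homogenize_to_1)
    show "peval (hom_part d p) x \<ge> \<epsilon> * peval (hom_part d r) x" if "x \<in> semialg_inf c E I" for x
      using *[of "(0, x)"] that norm_semialg_inf[OF that] deg r \<open>p \<in> polys_supp A\<close>
      by (simp add: semialg_hom_0 homogenize_to_0)
  qed
qed

text \<open>For a support set \<open>A\<close>, one polynomial supported in \<open>A\<close> that is strictly positive
  on \<open>K\<close> and at infinity is enough to describe the whole interior.\<close>

lemma interior_nonneg_polys_supp_eq:
  fixes c :: "'l \<Rightarrow> 'n::finite rpoly"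
  assumes closed: "closed_at_infinity c E I"
    and A: "finite A" "\<And>\<alpha>. \<alpha> \<in> A \<Longrightarrow> expo_deg \<alpha> \<le> d" and r: "r \<in> polys_supp A"
    and rK: "\<And>x. x \<in> semialg_set c E I \<Longrightarrow> peval r x > 0"
    and rKe: "\<And>x. x \<in> semialg_inf c E I \<Longrightarrow> peval (hom_part d r) x > 0"
  shows "interior_wrt (polys_supp A) (nonneg_polys_supp A (semialg_set c E I)) =
    {p \<in> polys_supp A. (\<forall>x\<in>semialg_set c E I. peval p x > 0) \<and>
       (\<forall>x\<in>semialg_inf c E I. peval (hom_part d p) x > 0)}" (is "?int = ?pos")
proof
  show "?pos \<subseteq> ?int"
    using pos_imp_interior[OF A] by blast
  show "?int \<subseteq> ?pos"
  proof
    fix p assume p: "p \<in> ?int"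
    then obtain \<epsilon> where "\<epsilon> > 0"
      and "\<And>x. x \<in> semialg_set c E I \<Longrightarrow> peval p x \<ge> \<epsilon> * peval r x"
      and "\<And>x. x \<in> semialg_inf c E I \<Longrightarrow> peval (hom_part d p) x \<ge> \<epsilon> * peval (hom_part d r) x"
      using interior_dominates[OF closed A(2) p r] by blast
    moreover have "p \<in> polys_supp A"
      using p by (simp add: interior_wrt_iff)
    ultimately show "p \<in> ?pos"
      using rK rKe by (force intro: less_le_trans[OF mult_pos_pos])
  qed
qed

lemma peval_single: "peval (Poly_Mapping.single \<alpha> a) x = a * monom_eval \<alpha> x"
  by (simp add: peval_def)

lemma monom_eval_single: "monom_eval (Poly_Mapping.single i k) x = (x $ i) ^ k"
proof -
  have "monom_eval (Poly_Mapping.single i k) x = (\<Prod>j\<in>UNIV. if j = i then (x $ j) ^ k else 1)"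
    unfolding monom_eval_def by (intro prod.cong) (auto simp: lookup_single when_def)
  then show ?thesis
    by simp
qed

lemma expo_deg_single: "expo_deg (Poly_Mapping.single i k) = k"
  by (simp add: expo_deg_def lookup_single when_def)

lemma hom_part_single:
  "hom_part d (Poly_Mapping.single \<alpha> a) = (if expo_deg \<alpha> = d then Poly_Mapping.single \<alpha> a else 0)"
  by (rule poly_mapping_eqI) (auto simp: lookup_hom_part lookup_single when_def)

lemma interior_nonneg_polys_deg_eq:
  fixes c :: "'l \<Rightarrow> 'n::finite rpoly"
  assumes closed: "closed_at_infinity c E I"
  shows "interior_wrt (polys_deg d) (nonneg_polys_deg d (semialg_set c E I)) =
    {p \<in> polys_deg d. (\<forall>x\<in>semialg_set c E I. peval p x > 0) \<and>
       (\<forall>x\<in>semialg_inf c E I. peval (hom_part d p) x > 0)}" (is "?int = ?pos")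
proof
  let ?A = "{\<alpha> :: 'n expo. expo_deg \<alpha> \<le> d}"
  show "?pos \<subseteq> ?int"
    unfolding polys_deg_eq_polys_supp nonneg_polys_deg_eq
    using pos_imp_interior[OF finite_expo_deg_le, of d] by blast
  show "?int \<subseteq> ?pos"
  proof
    fix p assume "p \<in> ?int"
    then have p: "p \<in> interior_wrt (polys_supp ?A) (nonneg_polys_supp ?A (semialg_set c E I))"
      by (simp add: polys_deg_eq_polys_supp nonneg_polys_deg_eq)
    have A: "\<And>\<alpha>. \<alpha> \<in> ?A \<Longrightarrow> expo_deg \<alpha> \<le> d"
      by simp
    have "peval p x > 0" if x: "x \<in> semialg_set c E I" for x
    proof -
      let ?one = "Poly_Mapping.single 0 1 :: 'n rpoly"
      have "?one \<in> polys_supp ?A"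
        by (simp add: polys_supp_def expo_deg_def)
      from interior_dominates[OF closed A p this]
      obtain \<epsilon> where "\<epsilon> > 0" "peval p x \<ge> \<epsilon> * peval ?one x"
        using x by blast
      moreover have "peval ?one x = 1"
        by (simp only: peval_single) (simp add: monom_eval_def)
      ultimately show ?thesis
        by simp
    qed
    moreover have "peval (hom_part d p) x > 0" if x: "x \<in> semialg_inf c E I" for x
    proof -
      have "x \<noteq> 0"
        using norm_semialg_inf[OF x] by auto
      then obtain i where i: "x $ i \<noteq> 0"
        by (auto simp: vec_eq_iff)
      \<comment> \<open>The sign makes the value at \<open>x\<close> equal to \<open>\<bar>x\<^sub>i ^ d\<bar> > 0\<close>.\<close>
      let ?r = "Poly_Mapping.single (Poly_Mapping.single i d) (sgn ((x $ i) ^ d)) :: 'n rpoly"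
      have "?r \<in> polys_supp ?A"
        by (simp add: polys_supp_def expo_deg_single)
      from interior_dominates[OF closed A p this]
      obtain \<epsilon> where "\<epsilon> > 0" "peval (hom_part d p) x \<ge> \<epsilon> * peval (hom_part d ?r) x"
        using x by blast
      moreover have "peval (hom_part d ?r) x = \<bar>(x $ i) ^ d\<bar>"
        by (simp add: hom_part_single expo_deg_single peval_single monom_eval_single abs_sgn mult.commute)
      moreover have "\<epsilon> * \<bar>(x $ i) ^ d\<bar> > 0"
        using \<open>\<epsilon> > 0\<close> i by simp
      ultimately show ?thesis
        by simp
    qed
    ultimately show "p \<in> ?pos"
      using \<open>p \<in> ?int\<close> by (simp add: interior_wrt_iff)
  qed
qed

theorem theorem3p4:
  fixes c :: "'l \<Rightarrow> 'n::finite rpoly" and E I :: "'l set" and K :: "(real^'n) set"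
  assumes "finite E" and "finite I"
    and "K = semialg_set c E I"
    and "closed_at_infinity c E I"
  shows "(\<forall>d>0. interior_wrt (polys_deg d) (nonneg_polys_deg d K) =
            {p \<in> polys_deg d. (\<forall>x\<in>K. peval p x > 0) \<and>
               (\<forall>x\<in>semialg_inf c E I. peval (hom_part d p) x > 0)})
       \<and> (\<forall>A d. finite A \<longrightarrow> d = supp_deg A \<longrightarrow>
            polys_supp A \<inter> interior_wrt (polys_deg d) (nonneg_polys_deg d K) \<noteq> {} \<longrightarrow>
            interior_wrt (polys_supp A) (nonneg_polys_supp A K) =
            {p \<in> polys_supp A. (\<forall>x\<in>K. peval p x > 0) \<and>
               (\<forall>x\<in>semialg_inf c E I. peval (hom_part d p) x > 0)})"
proof (intro conjI allI impI)
  show "interior_wrt (polys_deg d) (nonneg_polys_deg d K) =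
      {p \<in> polys_deg d. (\<forall>x\<in>K. peval p x > 0) \<and>
         (\<forall>x\<in>semialg_inf c E I. peval (hom_part d p) x > 0)}" for d
    unfolding assms(3) by (rule interior_nonneg_polys_deg_eq[OF assms(4)])
next
  fix A :: "'n expo set" and d
  assume A: "finite A" "d = supp_deg A"
    and "polys_supp A \<inter> interior_wrt (polys_deg d) (nonneg_polys_deg d K) \<noteq> {}"
  then obtain r where "r \<in> polys_supp A"
    and "r \<in> interior_wrt (polys_deg d) (nonneg_polys_deg d (semialg_set c E I))"
    using assms(3) by blast
  moreover have "expo_deg \<alpha> \<le> d" if "\<alpha> \<in> A" for \<alpha>
    using A that by (simp add: supp_deg_def)
  ultimately show "interior_wrt (polys_supp A) (nonneg_polys_supp A K) =
      {p \<in> polys_supp A. (\<forall>x\<in>K. peval p x > 0) \<and>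
         (\<forall>x\<in>semialg_inf c E I. peval (hom_part d p) x > 0)}"
    unfolding assms(3) interior_nonneg_polys_deg_eq[OF assms(4)]
    using interior_nonneg_polys_supp_eq[OF assms(4) A(1)] by blast
qed

end
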